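(* Let $d$ and $k$ be positive integers. If $P$ and $Q$ are disjoint lattice $(d,k)$-polytopes, then $$d(P,Q)\geq\frac{1}{(kd)^{2d}}.$$
   Context: A polytope in $\mathbb{R}^d$ is the convex hull of a non-empty finite set of points. A lattice polytope is a polytope all of whose vertices belong to $\mathbb{Z}^d$. A lattice $(d,k)$-polytope is a lattice polytope (of any dimension) contained in the hypercube $[0,k]^d$. $d(P,Q)$ denotes the minimal Euclidean distance between a point of $P$ and a point of $Q$ (the letter $d$ alone denotes the dimension of the ambient space). *)

theory Defs
  imports "HOL-Analysis.Analysis"
begin

text \<open>
  The dimension \<open>d\<close> is \<open>CARD('n)\<close>, for an arbitrary finite index type \<open>'n\<close>. The library predicate
  \<^const>\<open>polytope\<close> also holds of the empty set, so non-emptiness is required separately.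
  The vertices of a polytope are its extreme points.
\<close>

definition lattice_polytope :: "(real ^ 'n) set \<Rightarrow> bool" where
  "lattice_polytope P \<longleftrightarrow>
     polytope P \<and> P \<noteq> {} \<and> (\<forall>v. v extreme_point_of P \<longrightarrow> (\<forall>i. v $ i \<in> \<int>))"

definition lattice_dk_polytope :: "nat \<Rightarrow> (real ^ 'n) set \<Rightarrow> bool" where
  "lattice_dk_polytope k P \<longleftrightarrow> lattice_polytope P \<and> P \<subseteq> cbox 0 (vec (real k))"

end

theory Submission
  imports Defs
begin

text \<open>
  Let \<open>p \<in> P\<close> and \<open>q \<in> Q\<close> be nearest points and \<open>n = p - q\<close>. They lie in the faces of \<open>P\<close> and \<open>Q\<close>
  exposed by \<open>n\<close>; if \<open>L\<close> is spanned by the vertex differences within each face, \<open>n\<close> is orthogonal to \<open>L\<close>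
  and congruent modulo \<open>L\<close> to a difference \<open>z\<close> of two lattice points, so \<open>z \<notin> L\<close>. Complete a basis
  of \<open>L\<close> among these differences by \<open>z\<close> and unit vectors to a basis of the whole space, and let \<open>\<phi> x\<close>
  be the determinant of this basis with \<open>z\<close> replaced by \<open>x\<close>. The linear form \<open>\<phi>\<close> vanishes on \<open>L\<close>,
  so \<open>\<phi> n = \<phi> z\<close> is a non-zero integer, while the coefficients of \<open>\<phi>\<close> are determinants of matrices
  with small entries. Hence \<open>n\<close> cannot be short.
\<close>

lemma det_in_Ints:
  fixes A :: "real ^ 'n ^ 'n"
  assumes "\<And>i j. A $ i $ j \<in> \<int>"
  shows "det A \<in> \<int>"
  unfolding det_def by (intro Ints_sum Ints_mult Ints_of_int Ints_prod assms)

text \<open>The Leibniz expansion has \<open>fact CARD('n)\<close> terms, each a signed product of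
  \<open>CARD('n)\<close> entries.\<close>

lemma abs_det_le:
  fixes A :: "real ^ 'n ^ 'n"
  assumes "\<And>i j. \<bar>A $ i $ j\<bar> \<le> K"
  shows "\<bar>det A\<bar> \<le> fact CARD('n) * K ^ CARD('n)"
proof -
  have "\<bar>det A\<bar> \<le> (\<Sum>p | p permutes (UNIV :: 'n set).
          \<bar>of_int (sign p) * (\<Prod>i\<in>UNIV. A $ i $ p i)\<bar>)"
    unfolding det_def by (rule sum_abs)
  also have "\<dots> \<le> (\<Sum>p | p permutes (UNIV :: 'n set). K ^ CARD('n))"
  proof (rule sum_mono)
    fix p :: "'n \<Rightarrow> 'n"
    have "\<bar>of_int (sign p) * (\<Prod>i\<in>UNIV. A $ i $ p i)\<bar> = (\<Prod>i\<in>UNIV. \<bar>A $ i $ p i\<bar>)"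
      by (simp add: abs_mult abs_prod sign_def)
    also have "\<dots> \<le> (\<Prod>i\<in>(UNIV :: 'n set). K)"
      by (intro prod_mono) (simp add: assms)
    finally show "\<bar>of_int (sign p) * (\<Prod>i\<in>UNIV. A $ i $ p i)\<bar> \<le> K ^ CARD('n)"
      by simp
  qed
  also have "\<dots> = fact CARD('n) * K ^ CARD('n)"
    by (simp add: card_permutations)
  finally show ?thesis .
qed

lemma linear_det_row:
  fixes c :: "'n \<Rightarrow> real ^ 'n"
  shows "linear (\<lambda>x. det (\<chi> i. if i = m then x else c i))"
proof (rule linearI)
  show "det (\<chi> i. if i = m then r *\<^sub>R x else c i) = r *\<^sub>R det (\<chi> i. if i = m then x else c i)"
    for r x
    using det_row_mul[of m r "\<lambda>_. x" c] unfolding scalar_mult_eq_scaleR real_scaleR_def .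
qed (rule det_row_add)

text \<open>The determinant argument, separated from the polytopes. In the application
  \<open>D\<close> holds the vertex differences within the two faces, \<open>z\<close> is a vertex
  difference across them, and \<open>K\<close> is \<open>k\<close>.\<close>

lemma norm_ge_of_congruent_lattice_vector:
  fixes n z :: "real ^ 'n" and D :: "(real ^ 'n) set"
  assumes D_int: "\<And>u i. u \<in> D \<Longrightarrow> u $ i \<in> \<int>" and D_le: "\<And>u i. u \<in> D \<Longrightarrow> \<bar>u $ i\<bar> \<le> K"
    and z_int: "\<And>i. z $ i \<in> \<int>" and z_le: "\<And>i. \<bar>z $ i\<bar> \<le> K"
    and "z - n \<in> span D" and "z \<notin> span D" and "K \<ge> 1"
  shows "1 \<le> real CARD('n) * (fact CARD('n) * K ^ CARD('n)) * norm n"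
proof -
  obtain B where B: "B \<subseteq> D" "independent B" "D \<subseteq> span B"
    \<comment> \<open>Choosing the basis inside \<open>D\<close> keeps its entries integral and
      bounded by \<open>K\<close>.\<close>
    using maximal_independent_subset by blast
  have span_B: "span B = span D"
    using B by (meson span_eq span_superset subset_trans)
  have "z \<notin> span B"
    using assms(6) span_B by simp
  then have "independent (insert z B)"
    using B(2) by (simp add: independent_insertI)
  \<comment> \<open>The added vectors come from \<open>Basis\<close>: their entries are 0 or 1,
    hence also integral and at most \<open>K\<close>.\<close>
  then obtain C where C: "insert z B \<subseteq> C" "C \<subseteq> insert z B \<union> Basis" "independent C"
      "insert z B \<union> Basis \<subseteq> span C"
    using maximal_independent_subset_extend[of "insert z B" "insert z B \<union> Basis"] by blast
  have span_C: "span C = UNIV"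
    using C(4) by (metis le_sup_iff span_Basis span_minimal subspace_span top.extremum_uniqueI)
  have "finite C" "card C = CARD('n)"
    using C(3) span_C independent_bound dim_eq_card[of C UNIV]
    by (auto simp: independent_imp_finite)
  then obtain f :: "'n \<Rightarrow> real ^ 'n" where f: "bij_betw f UNIV C"
    by (metis finite_same_card_bij finite_class.finite_UNIV)
  then obtain m where m: "f m = z"
    using C(1) by (metis bij_betw_imp_surj_on image_iff insert_subset)
  have f_int: "f i $ j \<in> \<int>" and f_le: "\<bar>f i $ j\<bar> \<le> K" for i j
  proof -
    have "f i \<in> insert z D \<union> Basis"
      using f C(2) B(1) by (auto simp: bij_betw_def)
    then show "f i $ j \<in> \<int>" "\<bar>f i $ j\<bar> \<le> K"
      using D_int D_le z_int z_le \<open>K \<ge> 1\<close> by (auto simp: Basis_vec_def axis_def)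
  qed
  define \<phi> where "\<phi> x = det (\<chi> i. if i = m then x else f i)" for x
  have lin: "linear \<phi>"
    unfolding \<phi>_def by (rule linear_det_row)
  have "\<phi> u = 0" if "u \<in> B" for u
  proof -
    have "u \<in> range f"
      unfolding bij_betw_imp_surj_on[OF f] using that C(1) by blast
    then obtain i where i: "f i = u"
      by blast
    \<comment> \<open>Since \<open>z\<close> lies outside \<open>span B\<close>, \<open>u\<close> is
      a row other than \<open>z\<close>; putting \<open>u\<close> in row \<open>m\<close> therefore
      repeats a row.\<close>
    have "i \<noteq> m"
      using i m that \<open>z \<notin> span B\<close> span_base by blast
    then show ?thesis
      unfolding \<phi>_def using i
      by (intro det_identical_rows[of i m]) (auto simp: row_def vec_eq_iff)
  qed
  then have "\<phi> (z - n) = 0"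
    using assms(5) span_B linear_eq_0_on_span[OF lin] by blast
  then have eq: "\<phi> n = \<phi> z"
    by (simp add: linear_diff[OF lin])
  have z: "\<phi> z = det (\<chi> i. f i)"
    unfolding \<phi>_def by (rule arg_cong[of _ _ det]) (auto simp: vec_eq_iff m)
  have "rows (\<chi> i. f i) = C"
    using f by (auto simp: rows_def row_def bij_betw_def)
  \<comment> \<open>The rows span the whole space, so the matrix is invertible.\<close>
  then have "\<phi> z \<noteq> 0"
    unfolding z
    by (metis invertible_det_nz invertible_left_inverse matrix_left_invertible_span_rows span_C)
  moreover have "\<phi> z \<in> \<int>"
    unfolding z by (rule det_in_Ints) (simp add: f_int)
  ultimately have "1 \<le> \<bar>\<phi> n\<bar>"
    unfolding eq by (simp add: Ints_nonzero_abs_ge1)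
  also have "\<phi> n = (\<Sum>j\<in>UNIV. n $ j * \<phi> (axis j 1))"
    by (subst (1) basis_expansion[of n, symmetric])
      (simp only: linear_sum[OF lin] linear_cmul[OF lin] scalar_mult_eq_scaleR real_scaleR_def)
  also have "\<bar>\<dots>\<bar> \<le> (\<Sum>j\<in>UNIV. \<bar>n $ j * \<phi> (axis j 1)\<bar>)"
    by (rule sum_abs)
  \<comment> \<open>Each coefficient \<open>\<phi> (axis j 1)\<close> is a determinant whose row
    \<open>m\<close> is a unit vector, so all its entries are still at most
    \<open>K\<close>.\<close>
  also have "\<dots> \<le> (\<Sum>j\<in>(UNIV :: 'n set). norm n * (fact CARD('n) * K ^ CARD('n)))"
    unfolding abs_mult
  proof (intro sum_mono mult_mono component_le_norm_cart)
    show "\<bar>\<phi> (axis j 1)\<bar> \<le> fact CARD('n) * K ^ CARD('n)" for j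
      unfolding \<phi>_def using f_le \<open>K \<ge> 1\<close> by (intro abs_det_le) (auto simp: axis_def)
  qed auto
  finally show ?thesis
    by (simp add: mult_ac)
qed

text \<open>The face of \<open>P\<close> where \<open>n\<close> attains its minimum is the convex
  hull of its extreme points by Krein-Milman, and extreme points of a face are extreme points of
  \<open>P\<close>.\<close>

lemma extreme_points_exposed_face:
  fixes P :: "(real ^ 'n) set"
  assumes "compact P" "convex P" "p \<in> P" "\<And>x. x \<in> P \<Longrightarrow> n \<bullet> x \<ge> n \<bullet> p"
  shows "p \<in> convex hull {v. v extreme_point_of P \<and> n \<bullet> v = n \<bullet> p}"
proof -
  define F where "F = P \<inter> {x. n \<bullet> x = n \<bullet> p}"
  have face: "F face_of P"
    unfolding F_def using assms by (intro face_of_Int_supporting_hyperplane_ge)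
  have "F = convex hull {v. v extreme_point_of F}"
    using face assms face_of_imp_compact face_of_imp_convex
    by (intro Krein_Milman_Minkowski) blast+
  moreover have "{v. v extreme_point_of F} \<subseteq> {v. v extreme_point_of P \<and> n \<bullet> v = n \<bullet> p}"
    using extreme_point_of_face[OF face] by (auto simp: F_def)
  moreover have "p \<in> F"
    using assms by (simp add: F_def)
  ultimately show ?thesis
    using hull_mono by blast
qed

text \<open>The translate of the span by \<open>v\<close> is convex and contains \<open>V\<close>,
  hence contains its hull.\<close>

lemma diff_in_span_of_convex_hull:
  fixes V :: "'a::real_vector set"
  assumes "p \<in> convex hull V"
  shows "p - v \<in> span ((\<lambda>x. x - v) ` V)"
proof -
  let ?L = "span ((\<lambda>x. x - v) ` V)"
  have "V \<subseteq> (+) v ` ?L"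
  proof
    fix x assume "x \<in> V"
    then have "x - v \<in> ?L"
      by (intro span_base imageI)
    then show "x \<in> (+) v ` ?L"
      by (rule rev_image_eqI) simp
  qed
  moreover have "convex ((+) v ` ?L)"
    by (intro convex_translation subspace_imp_convex subspace_span)
  ultimately have "convex hull V \<subseteq> (+) v ` ?L"
    by (rule hull_minimal)
  then show ?thesis
    using assms by auto
qed

text \<open>Combines \<open>d \<le> d ^ d\<close>, \<open>fact d \<le> d ^ d\<close> and
  \<open>k ^ d \<le> k ^ (2 * d)\<close>.\<close>

lemma mult_fact_power_le:
  assumes "d \<ge> 1" "k \<ge> (1::nat)"
  shows "real d * (fact d * real k ^ d) \<le> (real k * real d) ^ (2 * d)"
proof -
  have "d * (fact d * k ^ d) \<le> d ^ d * (d ^ d * k ^ (2 * d))"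
    using assms fact_le_power[of d, where 'a = nat]
    by (intro mult_mono self_le_power power_increasing) auto
  also have "\<dots> = (k * d) ^ (2 * d)"
    by (simp add: power_mult_distrib power_add mult_2)
  finally have "real (d * (fact d * k ^ d)) \<le> real ((k * d) ^ (2 * d))"
    by (rule of_nat_mono)
  then show ?thesis
    by simp
qed

theorem theorem1p1:
  fixes P Q :: "(real ^ 'n) set" and k :: nat
  assumes "k \<ge> 1"
    and "lattice_dk_polytope k P" and "lattice_dk_polytope k Q"
    and "P \<inter> Q = {}"
  shows "setdist P Q \<ge> 1 / (real k * real CARD('n)) ^ (2 * CARD('n))"
proof -
  have P: "compact P" "convex P" "P \<noteq> {}" and Q: "compact Q" "convex Q" "Q \<noteq> {}"
    using assms(2,3)
    by (auto simp: lattice_dk_polytope_def lattice_polytope_def polytope_imp_compact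
        polytope_imp_convex)
  have int: "v $ i \<in> \<int>" and box: "0 \<le> v $ i" "v $ i \<le> real k"
    if "v extreme_point_of P \<or> v extreme_point_of Q" for v i
  proof -
    show "v $ i \<in> \<int>"
      using that assms(2,3) by (auto simp: lattice_dk_polytope_def lattice_polytope_def)
    have "v \<in> cbox 0 (vec (real k))"
      using that assms(2,3) by (auto simp: lattice_dk_polytope_def extreme_point_of_def)
    then show "0 \<le> v $ i" "v $ i \<le> real k"
      by (auto simp: mem_box_cart)
  qed
  have diff_int: "(v - w) $ i \<in> \<int>" and diff_le: "\<bar>(v - w) $ i\<bar> \<le> real k"
    if "v extreme_point_of P \<or> v extreme_point_of Q" "w extreme_point_of P \<or> w extreme_point_of Q"
    for v w i
    using int[OF that(1), of i] int[OF that(2), of i] box[OF that(1), of i] box[OF that(2), of i]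
    by auto
  obtain p q where pq: "p \<in> P" "q \<in> Q" "dist p q = setdist P Q"
    using setdist_compact_closed[OF P(1) compact_imp_closed[OF Q(1)]] P Q by blast
  define n where "n = p - q"
  have "n \<noteq> 0"
    using pq assms(4) by (auto simp: n_def)
  have supp_P: "n \<bullet> x \<ge> n \<bullet> p" if "x \<in> P" for x
  proof -
    \<comment> \<open>As \<open>p\<close> is the point of the convex set \<open>P\<close> nearest to
      \<open>q\<close>, no direction from \<open>p\<close> into \<open>P\<close> makes an acute
      angle with \<open>q - p\<close>.\<close>
    have "\<forall>y\<in>P. dist q p \<le> dist q y"
      using pq by (metis dist_commute setdist_le_dist)
    then have "(q - p) \<bullet> (x - p) \<le> 0"
      using any_closest_point_dot[OF P(2) compact_imp_closed[OF P(1)] pq(1) that] by blast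
    then show ?thesis
      by (simp add: n_def inner_diff_left inner_diff_right)
  qed
  have supp_Q: "(- n) \<bullet> y \<ge> (- n) \<bullet> q" if "y \<in> Q" for y
  proof -
    have "\<forall>y\<in>Q. dist p q \<le> dist p y"
      using pq by (metis setdist_le_dist)
    then have "(p - q) \<bullet> (y - q) \<le> 0"
      using any_closest_point_dot[OF Q(2) compact_imp_closed[OF Q(1)] pq(2) that] by blast
    then show ?thesis
      by (simp add: n_def inner_diff_left inner_diff_right)
  qed
  define V where "V = {v. v extreme_point_of P \<and> n \<bullet> v = n \<bullet> p}"
  define W where "W = {w. w extreme_point_of Q \<and> n \<bullet> w = n \<bullet> q}"
  have p: "p \<in> convex hull V"
    unfolding V_def by (rule extreme_points_exposed_face[OF P(1,2) pq(1) supp_P])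
  have q: "q \<in> convex hull W"
    unfolding W_def using extreme_points_exposed_face[OF Q(1,2) pq(2) supp_Q] by simp
  \<comment> \<open>Both sets are non-empty because their hulls contain \<open>p\<close> and
    \<open>q\<close>.\<close>
  obtain v w where v: "v \<in> V" and w: "w \<in> W"
    using p q by fastforce
  define D where "D = (\<lambda>x. x - v) ` V \<union> (\<lambda>x. x - w) ` W"
  have "p - v \<in> span D" "q - w \<in> span D"
    using diff_in_span_of_convex_hull[OF p, of v] diff_in_span_of_convex_hull[OF q, of w]
      span_mono[of _ D] unfolding D_def by blast+
  then have "(q - w) - (p - v) \<in> span D"
    by (rule span_diff[rotated])
  then have zn: "(v - w) - n \<in> span D"
    by (simp add: n_def algebra_simps)
  \<comment> \<open>\<open>n\<close> has constant inner product on \<open>V\<close> and on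
    \<open>W\<close>, so it is orthogonal to \<open>D\<close>; inside \<open>span D\<close> it would
    be orthogonal to itself.\<close>
  have "n \<notin> span D"
  proof
    assume "n \<in> span D"
    moreover have "n \<bullet> u = 0" if "u \<in> D" for u
      using that v w by (auto simp: D_def V_def W_def inner_diff_right)
    ultimately have "n \<bullet> n = 0"
      using orthogonal_to_span[of n D n] by (simp add: orthogonal_def)
    with \<open>n \<noteq> 0\<close> show False
      by simp
  qed
  then have z: "v - w \<notin> span D"
    using zn span_diff[of "v - w" D "(v - w) - n"] by auto
  have ext: "x extreme_point_of P \<or> x extreme_point_of Q" if "x \<in> V \<union> W" for x
    using that by (auto simp: V_def W_def)
  let ?M = "real CARD('n) * (fact CARD('n) * real k ^ CARD('n))"
  have D: "u $ i \<in> \<int>" "\<bar>u $ i\<bar> \<le> real k" if "u \<in> D" for u i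
  proof -
    have "\<exists>x \<in> V \<union> W. \<exists>y \<in> V \<union> W. u = x - y"
      using that v w by (auto simp: D_def)
    then show "u $ i \<in> \<int>" "\<bar>u $ i\<bar> \<le> real k"
      using diff_int diff_le ext by blast+
  qed
  have "1 \<le> ?M * norm n"
  proof (rule norm_ge_of_congruent_lattice_vector[OF D _ _ zn z])
    show "(v - w) $ i \<in> \<int>" "\<bar>(v - w) $ i\<bar> \<le> real k" for i
      using diff_int diff_le ext v w by blast+
  qed (use assms(1) in auto)
  also have "\<dots> \<le> (real k * real CARD('n)) ^ (2 * CARD('n)) * norm n"
    using assms(1) by (intro mult_right_mono mult_fact_power_le) auto
  finally have "1 / (real k * real CARD('n)) ^ (2 * CARD('n)) \<le> norm n"
    using assms(1) by (simp add: divide_le_eq mult.commute)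
  then show ?thesis
    using pq(3) by (simp add: n_def dist_norm)
qed

end
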